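(* Let $\varepsilon>0$ and $\boldsymbol\theta=(\theta_1,\dots,\theta_N)\in\mathbb{R}^{K\times N}$. For any $c\in\mathbb{R}^K$, define $\boldsymbol\theta'=(\theta'_1,\dots,\theta'_N)$ by $\theta'_i:=\theta_i+c$ for all $i\in[N]$. Then for all $x\in\Omega$, \[ F_{\boldsymbol\theta'}(x)=F_{\boldsymbol\theta}(x),\qquad (p_{\boldsymbol\theta'}^\varepsilon)_i(x)=(p_{\boldsymbol\theta}^\varepsilon)_i(x)\quad\text{for all } i\in[N], \] and hence $\Phi_\varepsilon^G(\boldsymbol\theta')=\Phi_\varepsilon^G(\boldsymbol\theta)$.
   Context: Let $\overline\Omega=[-1,1]^2$ and let $\Omega\subset\overline\Omega$ be a nonempty finite set (of pixels). Let $N>1$ and $K\ge 1$ be integers and $[N]:=\{1,\dots,N\}$. Let $G:\Omega\to[N]$ be a given map (the grain map) and $\eta:\overline\Omega\to\mathbb{R}^K$ a given function (the design function). For $\boldsymbol\theta=(\theta_1,\dots,\theta_N)\in\mathbb{R}^{K\times N}$ with $\theta_i\in\mathbb{R}^K$, set $h_{\theta_i}(x):=\theta_i\cdot\eta(x)$ for $x\in\overline\Omega$. Hard assignment: $F_{\boldsymbol\theta}(x):=\operatorname{arg\,min}_{i\in[N]}h_{\theta_i}(x)$, where if the minimiser is not unique the smallest minimising index is selected. Soft assignment, for $\varepsilon>0$: \[ (p_{\boldsymbol\theta}^\varepsilon)_i(x):=\frac{\exp\left(-\frac1\varepsilon h_{\theta_i}(x)\right)}{\sum_{j=1}^N\exp\left(-\frac1\varepsilon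 h_{\theta_j}(x)\right)},\qquad i\in[N]. \] Objective function, for $\varepsilon>0$: \[ \Phi_\varepsilon^G(\boldsymbol\theta):=\frac{1}{|\Omega|}\sum_{x\in\Omega}\log\big((p_{\boldsymbol\theta}^\varepsilon)_{G(x)}(x)\big). \] *)

theory Defs
  imports "HOL-Analysis.Analysis"
begin

definition image_domain :: "(real \<times> real) set" where
  "image_domain = {-1..1} \<times> {-1..1}"

text \<open>
  A K by N real parameter matrix is given by its columns, as a function
  from indices to \<^typ>\<open>real ^ 'k\<close> with \<open>K = CARD('k)\<close>; only its values on \<open>{1..N}\<close> are meant.
  Likewise, only the values of the design function \<open>\<eta>\<close> on \<^const>\<open>image_domain\<close> are meant.
\<close>

definition h_fun :: "(real \<times> real \<Rightarrow> real ^ 'k) \<Rightarrow> real ^ 'k \<Rightarrow> real \<times> real \<Rightarrow> real" where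
  "h_fun \<eta> v x = v \<bullet> \<eta> x"

definition hard_assignment ::
    "nat \<Rightarrow> (real \<times> real \<Rightarrow> real ^ 'k) \<Rightarrow> (nat \<Rightarrow> real ^ 'k) \<Rightarrow> real \<times> real \<Rightarrow> nat" where
  "hard_assignment N \<eta> \<theta> x =
     (LEAST i. is_arg_min (\<lambda>i. h_fun \<eta> (\<theta> i) x) (\<lambda>i. i \<in> {1..N}) i)"

definition soft_assignment ::
    "nat \<Rightarrow> (real \<times> real \<Rightarrow> real ^ 'k) \<Rightarrow> real \<Rightarrow> (nat \<Rightarrow> real ^ 'k) \<Rightarrow> nat \<Rightarrow> real \<times> real \<Rightarrow> real" where
  "soft_assignment N \<eta> \<epsilon> \<theta> i x =
     exp (- (1 / \<epsilon>) * h_fun \<eta> (\<theta> i) x) / (\<Sum>j = 1..N. exp (- (1 / \<epsilon>) * h_fun \<eta> (\<theta> j) x))"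

definition objective ::
    "nat \<Rightarrow> (real \<times> real \<Rightarrow> real ^ 'k) \<Rightarrow> (real \<times> real) set \<Rightarrow> (real \<times> real \<Rightarrow> nat) \<Rightarrow>
       real \<Rightarrow> (nat \<Rightarrow> real ^ 'k) \<Rightarrow> real" where
  "objective N \<eta> \<Omega> G \<epsilon> \<theta> =
     1 / real (card \<Omega>) * (\<Sum>x\<in>\<Omega>. ln (soft_assignment N \<eta> \<epsilon> \<theta> (G x) x))"

end

theory Submission
  imports Defs
begin

text \<open>
  At a fixed pixel \<open>x\<close>, translating every parameter vector by \<open>c\<close> adds the same real number
  \<open>c \<bullet> \<eta> x\<close> to all the costs, by linearity of \<^const>\<open>h_fun\<close> in its parameter. A common additive
  constant changes no comparison between costs, so the set of minimising indices, and with it the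
  tie-breaking least one, stays the same. In the softmax the constant turns into a common positive
  factor, which cancels between numerator and denominator. The objective sees the parameters only
  through the soft assignments at the labels \<open>G x\<close>, so it is invariant as well.
\<close>

lemma h_fun_translate: "h_fun \<eta> (v + c) x = h_fun \<eta> v x + c \<bullet> \<eta> x"
  by (simp add: h_fun_def inner_add_left)

lemma hard_assignment_translate:
  assumes "\<forall>i\<in>{1..N}. \<theta>' i = \<theta> i + c"
  shows "hard_assignment N \<eta> \<theta>' x = hard_assignment N \<eta> \<theta> x"
proof -
  have "is_arg_min (\<lambda>i. h_fun \<eta> (\<theta>' i) x) (\<lambda>i. i \<in> {1..N}) =
        is_arg_min (\<lambda>i. h_fun \<eta> (\<theta> i) x) (\<lambda>i. i \<in> {1..N})"
    using assms by (auto simp: fun_eq_iff is_arg_min_def h_fun_translate)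
  then show ?thesis
    by (simp add: hard_assignment_def)
qed

lemma soft_assignment_translate:
  assumes shift: "\<forall>i\<in>{1..N}. \<theta>' i = \<theta> i + c" and i: "i \<in> {1..N}"
  shows "soft_assignment N \<eta> \<epsilon> \<theta>' i x = soft_assignment N \<eta> \<epsilon> \<theta> i x"
proof -
  define a where "a = exp (- (1 / \<epsilon>) * (c \<bullet> \<eta> x))"
  have weight: "exp (- (1 / \<epsilon>) * h_fun \<eta> (\<theta>' j) x) = a * exp (- (1 / \<epsilon>) * h_fun \<eta> (\<theta> j) x)"
    if "j \<in> {1..N}" for j
    using shift that
    by (simp add: a_def h_fun_translate add_divide_distrib flip: exp_add)
  have "(\<Sum>j = 1..N. exp (- (1 / \<epsilon>) * h_fun \<eta> (\<theta>' j) x)) =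
        a * (\<Sum>j = 1..N. exp (- (1 / \<epsilon>) * h_fun \<eta> (\<theta> j) x))"
    unfolding sum_distrib_left by (rule sum.cong[OF refl weight])
  moreover have "a \<noteq> 0"
    by (simp add: a_def)
  ultimately show ?thesis
    unfolding soft_assignment_def weight[OF i] by simp
qed

theorem lemma4p2:
  fixes \<Omega> :: "(real \<times> real) set"
    and N :: nat
    and G :: "real \<times> real \<Rightarrow> nat"
    and \<eta> :: "real \<times> real \<Rightarrow> real ^ 'k"
    and \<epsilon> :: real
    and \<theta> \<theta>' :: "nat \<Rightarrow> real ^ 'k"
    and c :: "real ^ 'k"
  assumes "\<Omega> \<subseteq> image_domain" and "finite \<Omega>" and "\<Omega> \<noteq> {}"
    and "N > 1"
    and "G \<in> \<Omega> \<rightarrow> {1..N}"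
    and "\<epsilon> > 0"
    and "\<forall>i\<in>{1..N}. \<theta>' i = \<theta> i + c"
  shows "(\<forall>x\<in>\<Omega>. hard_assignment N \<eta> \<theta>' x = hard_assignment N \<eta> \<theta> x \<and>
            (\<forall>i\<in>{1..N}. soft_assignment N \<eta> \<epsilon> \<theta>' i x = soft_assignment N \<eta> \<epsilon> \<theta> i x)) \<and>
         objective N \<eta> \<Omega> G \<epsilon> \<theta>' = objective N \<eta> \<Omega> G \<epsilon> \<theta>"
proof (intro conjI ballI)
  fix x
  show "hard_assignment N \<eta> \<theta>' x = hard_assignment N \<eta> \<theta> x"
    using assms(7) by (rule hard_assignment_translate)
next
  fix x i assume "i \<in> {1..N}"
  with assms(7) show "soft_assignment N \<eta> \<epsilon> \<theta>' i x = soft_assignment N \<eta> \<epsilon> \<theta> i x"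
    by (rule soft_assignment_translate)
next
  have "soft_assignment N \<eta> \<epsilon> \<theta>' (G x) x = soft_assignment N \<eta> \<epsilon> \<theta> (G x) x" if "x \<in> \<Omega>" for x
    using assms(7) funcset_mem[OF assms(5) that] by (rule soft_assignment_translate)
  then show "objective N \<eta> \<Omega> G \<epsilon> \<theta>' = objective N \<eta> \<Omega> G \<epsilon> \<theta>"
    by (simp add: objective_def)
qed

end
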